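(* Let $(X,d)$ be a complete metric space, let $\Phi$ be a semiflow on $X$, and let $A\subset X$ be nonempty. Then $A$ is a compact minimal set of $\Phi$ if and only if for every point $x\in A$ there is a recurrent solution $\gamma:\mathbb{R}\to X$ of $\Phi$ through $x$ such that $A=\overline{\gamma(\mathbb{R})}$.
   Context: A semiflow on $X$ is a continuous map $\Phi:[0,\infty)\times X\to X$ with $\Phi(0,x)=x$ and $\Phi(t+s,x)=\Phi(t,\Phi(s,x))$ for all $x\in X$, $s,t\ge 0$; write $\Phi(t)K=\{\Phi(t,x):x\in K\}$. A flow is defined in the same way with $[0,\infty)$ replaced by $\mathbb{R}$. A set $K\subset X$ is invariant if $\Phi(t)K=K$ for all $t\ge 0$. A set is minimal if it is nonempty, closed and invariant and contains no proper subset with these three properties. A solution of $\Phi$ on an interval $J$ is a map $\gamma:J\to X$ with $\gamma(t)=\Phi(t-s,\gamma(s))$ for all $s,t\in J$, $t\ge s$; it is full if $J=\mathbb{R}$. A solution $\gamma$ is "through $x$" if $\gamma(t)=x$ for some $t\in J$. Recurrent functions: let $S=C(\mathbb{R},X)$ with the compact-open topology, metrized by the complete metric $$\rho(g_1,g_2)=\sum_{n=1}^\infty \frac1{2^n}\frac{\max_{t\in[-n,n]}d(g_1(t),g_2(t))}{1+\max_{t\in[-n,n]}d(g_1(t),g_2(t))},$$ and let $\theta_\tau g=g(\cdot+\tau)$, $\tau\in\mathbb{R}$, which defines a flow on $S$. A function $g\in S$ is recurrent if (1) for every $\varepsilon>0$ there is $l>0$ such that for all $a\in\mathbb{R}$ the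 $\rho$-distance from $g$ to the set $\{\theta_t g:t\in[a,a+l]\}$ is less than $\varepsilon$, and (2) the hull $\overline{\{\theta_t g:t\in\mathbb{R}\}}$ (closure in $(S,\rho)$) is compact. A recurrent solution of $\Phi$ is a full solution $\gamma:\mathbb{R}\to X$ which is a recurrent function. *)

theory Defs
  imports "HOL-Analysis.Analysis"
begin

text \<open>
  A semiflow on a metric space is encoded as a function on all of \<^typ>\<open>real\<close> in its time
  argument; its values at negative times are arbitrary and are never used.
\<close>

definition semiflow :: "(real \<Rightarrow> 'a::metric_space \<Rightarrow> 'a) \<Rightarrow> bool" where
  "semiflow \<Phi> \<longleftrightarrow>
     continuous_on ({0..} \<times> UNIV) (\<lambda>(t, x). \<Phi> t x) \<and>
     (\<forall>x. \<Phi> 0 x = x) \<and>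
     (\<forall>s\<ge>0. \<forall>t\<ge>0. \<forall>x. \<Phi> (t + s) x = \<Phi> t (\<Phi> s x))"

definition invariant :: "(real \<Rightarrow> 'a \<Rightarrow> 'a) \<Rightarrow> 'a set \<Rightarrow> bool" where
  "invariant \<Phi> K \<longleftrightarrow> (\<forall>t\<ge>0. \<Phi> t ` K = K)"

definition minimal_set :: "(real \<Rightarrow> 'a::metric_space \<Rightarrow> 'a) \<Rightarrow> 'a set \<Rightarrow> bool" where
  "minimal_set \<Phi> K \<longleftrightarrow>
     K \<noteq> {} \<and> closed K \<and> invariant \<Phi> K \<and>
     \<not> (\<exists>L. L \<subset> K \<and> L \<noteq> {} \<and> closed L \<and> invariant \<Phi> L)"

definition solution_on :: "real set \<Rightarrow> (real \<Rightarrow> 'a \<Rightarrow> 'a) \<Rightarrow> (real \<Rightarrow> 'a) \<Rightarrow> bool" where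
  "solution_on J \<Phi> \<gamma> \<longleftrightarrow> (\<forall>s\<in>J. \<forall>t\<in>J. s \<le> t \<longrightarrow> \<gamma> t = \<Phi> (t - s) (\<gamma> s))"

abbreviation full_solution :: "(real \<Rightarrow> 'a \<Rightarrow> 'a) \<Rightarrow> (real \<Rightarrow> 'a) \<Rightarrow> bool" where
  "full_solution \<equiv> solution_on UNIV"

definition through_on :: "real set \<Rightarrow> (real \<Rightarrow> 'a) \<Rightarrow> 'a \<Rightarrow> bool" where
  "through_on J \<gamma> x \<longleftrightarrow> (\<exists>t\<in>J. \<gamma> t = x)"

typedef (overloaded) ('a::metric_space) curve = "{g :: real \<Rightarrow> 'a. continuous_on UNIV g}"
  morphisms curve_apply Curve
proof
  show "(\<lambda>_. undefined) \<in> {g :: real \<Rightarrow> 'a. continuous_on UNIV g}" by simp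
qed

setup_lifting type_definition_curve

text \<open>
  The supremum below is attained, hence is the maximum of \<open>dist (g t) (h t)\<close> over \<open>[-n, n]\<close>;
  \<^const>\<open>Max\<close> is meaningful for finite sets only.
\<close>

definition maxdist :: "nat \<Rightarrow> 'a::metric_space curve \<Rightarrow> 'a curve \<Rightarrow> real" where
  "maxdist n g h = (SUP t\<in>{- real n..real n}. dist (curve_apply g t) (curve_apply h t))"

lemma continuous_on_dist_curve:
  "continuous_on S (\<lambda>t. dist (curve_apply g t) (curve_apply h t))"
  using curve_apply[of g] curve_apply[of h]
  by (auto intro!: continuous_on_dist intro: continuous_on_subset)

lemma compact_dist_curve:
  "compact ((\<lambda>t. dist (curve_apply g t) (curve_apply h t)) ` {- real n..real n})"
  by (intro compact_continuous_image continuous_on_dist_curve) auto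

lemma maxdist_attained:
  "\<exists>t\<in>{- real n..real n}. maxdist n g h = dist (curve_apply g t) (curve_apply h t)"
  unfolding maxdist_def
  using closed_contains_Sup[of "(\<lambda>t. dist (curve_apply g t) (curve_apply h t)) ` {- real n..real n}"]
    compact_dist_curve[of g h n]
  by (fastforce simp: compact_imp_closed compact_imp_bounded bounded_imp_bdd_above)

lemma dist_le_maxdist:
  assumes "\<bar>t\<bar> \<le> real n"
  shows "dist (curve_apply g t) (curve_apply h t) \<le> maxdist n g h"
  unfolding maxdist_def
  by (rule cSUP_upper)
    (use assms compact_dist_curve[of g h n] in \<open>auto simp: compact_imp_bounded bounded_imp_bdd_above\<close>)

lemma maxdist_nonneg: "0 \<le> maxdist n g h"
  by (rule order_trans[OF zero_le_dist dist_le_maxdist[of 0]]) simp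

lemma maxdist_commute: "maxdist n g h = maxdist n h g"
  by (simp add: maxdist_def dist_commute)

lemma maxdist_triangle: "maxdist n f h \<le> maxdist n f g + maxdist n g h"
  unfolding maxdist_def[of n f h]
proof (rule cSUP_least)
  fix t assume t: "t \<in> {- real n..real n}"
  then have "\<bar>t\<bar> \<le> real n" by auto
  then show "dist (curve_apply f t) (curve_apply h t) \<le> maxdist n f g + maxdist n g h"
    using dist_le_maxdist[of t n f g] dist_le_maxdist[of t n g h]
      dist_triangle[of "curve_apply f t" "curve_apply h t" "curve_apply g t"] by linarith
qed auto

definition rho_term :: "nat \<Rightarrow> 'a::metric_space curve \<Rightarrow> 'a curve \<Rightarrow> real" where
  "rho_term n g h = 1 / 2 ^ n * (maxdist n g h / (1 + maxdist n g h))"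

lemma rho_term_nonneg: "0 \<le> rho_term n g h"
  using maxdist_nonneg[of n g h] by (simp add: rho_term_def)

lemma rho_term_le: "rho_term n g h \<le> (1 / 2) ^ n"
proof -
  have "maxdist n g h / (1 + maxdist n g h) \<le> 1"
    using maxdist_nonneg[of n g h] by simp
  then have "1 / 2 ^ n * (maxdist n g h / (1 + maxdist n g h)) \<le> 1 / 2 ^ n * 1"
    by (intro mult_left_mono) auto
  then show ?thesis by (simp add: rho_term_def power_divide)
qed

lemma summable_rho_term: "summable (\<lambda>n. rho_term (Suc n) g h)"
proof (rule summable_comparison_test')
  show "summable (\<lambda>n. (1 / 2 :: real) ^ Suc n)"
    by (subst summable_Suc_iff) (simp add: summable_geometric)
  show "norm (rho_term (Suc n) g h) \<le> (1 / 2) ^ Suc n" for n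
    using rho_term_nonneg[of "Suc n" g h] rho_term_le[of "Suc n" g h] by simp
qed

lemma rho_term_triangle: "rho_term n f h \<le> rho_term n f g + rho_term n g h"
proof -
  have *: "c / (1 + c) \<le> a / (1 + a) + b / (1 + b)"
    if "0 \<le> a" "0 \<le> b" "0 \<le> c" "c \<le> a + b" for a b c :: real
  proof -
    have "c / (1 + c) \<le> (a + b) / (1 + (a + b))"
      using that by (simp add: divide_simps) (simp add: algebra_simps)
    also have "\<dots> = a / (1 + (a + b)) + b / (1 + (a + b))"
      by (simp add: add_divide_distrib)
    also have "\<dots> \<le> a / (1 + a) + b / (1 + b)"
      using that by (intro add_mono divide_left_mono) auto
    finally show ?thesis .
  qed
  have "1 / 2 ^ n * (maxdist n f h / (1 + maxdist n f h))
      \<le> 1 / 2 ^ n * (maxdist n f g / (1 + maxdist n f g) + maxdist n g h / (1 + maxdist n g h))"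
    by (intro mult_left_mono * maxdist_nonneg maxdist_triangle) auto
  then show ?thesis by (simp only: rho_term_def distrib_left)
qed

instantiation curve :: (metric_space) metric_space
begin

text \<open>The series runs over \<open>n \<ge> 1\<close>, hence the \<^const>\<open>Suc\<close>.\<close>

definition dist_curve :: "'a curve \<Rightarrow> 'a curve \<Rightarrow> real" where
  "dist_curve g h = (\<Sum>n. rho_term (Suc n) g h)"

definition uniformity_curve :: "('a curve \<times> 'a curve) filter" where
  "uniformity_curve = (INF e\<in>{0<..}. principal {(g, h). dist g h < e})"

definition open_curve :: "'a curve set \<Rightarrow> bool" where
  "open_curve U \<longleftrightarrow>
     (\<forall>g\<in>U. eventually (\<lambda>(g', h). g' = g \<longrightarrow> h \<in> U) (uniformity :: ('a curve \<times> 'a curve) filter))"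

instance
proof
  fix f g h :: "'a curve"
  have comm: "dist f h = dist h f" for f h :: "'a curve"
    by (simp add: dist_curve_def rho_term_def maxdist_commute)
  have tri: "dist f h \<le> dist f g + dist g h" for f g h :: "'a curve"
    unfolding dist_curve_def
    by (subst suminf_add[OF summable_rho_term summable_rho_term],
        intro suminf_le summable_add summable_rho_term rho_term_triangle)
  show "dist f g \<le> dist f h + dist g h"
    using tri[of f g h] comm[of h g] by simp
  show "dist f g = 0 \<longleftrightarrow> f = g"
  proof
    assume "f = g"
    then show "dist f g = 0"
      by (simp add: dist_curve_def rho_term_def maxdist_def)
  next
    assume "dist f g = 0"
    then have zero: "rho_term (Suc n) f g = 0" for n
      using suminf_eq_zero_iff[OF summable_rho_term[of f g]] rho_term_nonneg[of _ f g]
      by (simp add: dist_curve_def)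
    have "curve_apply f t = curve_apply g t" for t
    proof -
      obtain n where n: "\<bar>t\<bar> \<le> real n" using real_arch_simple by blast
      then have "\<bar>t\<bar> \<le> real (Suc n)" by simp
      moreover have "maxdist (Suc n) f g = 0"
        using zero[of n] maxdist_nonneg[of "Suc n" f g] by (simp add: rho_term_def)
      ultimately show ?thesis
        using dist_le_maxdist[of t "Suc n" f g] by simp
    qed
    then show "f = g" by (simp add: curve_apply_inject[symmetric] fun_eq_iff)
  qed
qed (simp_all add: uniformity_curve_def open_curve_def)

end

lift_definition shift :: "real \<Rightarrow> 'a::metric_space curve \<Rightarrow> 'a curve" is "\<lambda>\<tau> g t. g (t + \<tau>)"
  by (auto intro!: continuous_intros intro: continuous_on_compose2)

definition hull_of :: "'a::metric_space curve \<Rightarrow> 'a curve set" where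
  "hull_of g = closure (range (\<lambda>t. shift t g))"

definition recurrent :: "'a::metric_space curve \<Rightarrow> bool" where
  "recurrent g \<longleftrightarrow>
     (\<forall>\<epsilon>>0. \<exists>l>0. \<forall>a. infdist g ((\<lambda>t. shift t g) ` {a..a + l}) < \<epsilon>) \<and>
     compact (hull_of g)"

definition recurrent_solution ::
  "(real \<Rightarrow> 'a::metric_space \<Rightarrow> 'a) \<Rightarrow> (real \<Rightarrow> 'a) \<Rightarrow> bool" where
  "recurrent_solution \<Phi> \<gamma> \<longleftrightarrow>
     full_solution \<Phi> \<gamma> \<and> (\<exists>g. curve_apply g = \<gamma> \<and> recurrent g)"

end

theory Submission
  imports Defs
begin

text \<open>
  For the forward direction, the full solutions with values in a compact invariant set \<open>A\<close> form a
  compact set of curves: such a solution is determined by its values at \<open>0, -1, -2, \<dots>\<close>, so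
  compactness is inherited from the countable product of copies of \<open>A\<close>. By Zorn's lemma
  this set of curves contains a minimal set \<open>M\<close> of the shift flow, and Birkhoff's theorem makes every curve in \<open>M\<close> recurrent. Evaluation at time \<open>0\<close>
  intertwines the shift with \<open>\<Phi>\<close>, so it maps \<open>M\<close> onto a closed invariant subset of \<open>A\<close>, which is \<open>A\<close>
  by minimality; hence some recurrent solution passes through any given point.

  Conversely, let \<open>A\<close> be the closure of the range of a recurrent solution \<open>\<gamma>\<close>, let \<open>y\<close> be a point
  of a closed invariant \<open>L \<subseteq> A\<close>, and let \<open>\<gamma> (t\<^sub>n) \<longlonglongrightarrow> y\<close>. Any \<open>\<gamma> s\<close> is approximated, up to a
  prescribed error, by \<open>\<gamma>\<close> at some time in \<open>[t\<^sub>n, t\<^sub>n + l]\<close>, hence by \<open>\<Phi> r y \<in> L\<close> for some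
  \<open>r \<in> [0, l]\<close>. So \<open>L = A\<close>.
\<close>

section \<open>The metric on curves\<close>

lemma maxdist_le_iff:
  "maxdist n g h \<le> c \<longleftrightarrow> (\<forall>t\<in>{- real n..real n}. dist (curve_apply g t) (curve_apply h t) \<le> c)"
proof
  assume "maxdist n g h \<le> c"
  then show "\<forall>t\<in>{- real n..real n}. dist (curve_apply g t) (curve_apply h t) \<le> c"
    by (auto intro!: order_trans[OF dist_le_maxdist])
next
  assume "\<forall>t\<in>{- real n..real n}. dist (curve_apply g t) (curve_apply h t) \<le> c"
  then show "maxdist n g h \<le> c"
    using maxdist_attained[of n g h] by auto
qed

lemma maxdist_mono:
  assumes "m \<le> n"
  shows "maxdist m g h \<le> maxdist n g h"
  unfolding maxdist_le_iff[of m] using assms by (auto intro!: dist_le_maxdist)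

text \<open>Cut the series after \<open>N\<close> terms. The windows are nested and the weights sum
  to at most 1, so the head is at most the distance on the largest window; the tail is dominated by
  a geometric series with sum \<open>(1 / 2) ^ N\<close>.\<close>

lemma dist_curve_le: "dist g h \<le> maxdist N g h + (1 / 2) ^ N"
proof -
  have half: "(\<lambda>n. (1 / 2 :: real) ^ Suc n) sums 1"
    by (rule power_half_series)
  have head: "(\<Sum>n<N. rho_term (Suc n) g h) \<le> maxdist N g h"
  proof -
    have "(\<Sum>n<N. rho_term (Suc n) g h) \<le> (\<Sum>n<N. (1 / 2) ^ Suc n * maxdist N g h)"
    proof (rule sum_mono)
      fix n assume "n \<in> {..<N}"
      then have le: "maxdist (Suc n) g h \<le> maxdist N g h"
        by (intro maxdist_mono) auto
      have "maxdist (Suc n) g h / (1 + maxdist (Suc n) g h) \<le> maxdist (Suc n) g h"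
        using maxdist_nonneg[of "Suc n" g h] by (simp add: divide_simps mult_le_cancel_left1)
      then have "maxdist (Suc n) g h / (1 + maxdist (Suc n) g h) \<le> maxdist N g h"
        using le by linarith
      then have "1 / 2 ^ Suc n * (maxdist (Suc n) g h / (1 + maxdist (Suc n) g h))
          \<le> 1 / 2 ^ Suc n * maxdist N g h"
        by (intro mult_left_mono) auto
      then show "rho_term (Suc n) g h \<le> (1 / 2) ^ Suc n * maxdist N g h"
        by (simp only: rho_term_def power_divide power_one)
    qed
    also have "\<dots> = (\<Sum>n<N. (1 / 2) ^ Suc n) * maxdist N g h"
      by (simp only: sum_distrib_right)
    also have "\<dots> \<le> 1 * maxdist N g h"
      using sum_le_suminf[OF sums_summable[OF half], of "{..<N}"] sums_unique[OF half]
      by (intro mult_right_mono maxdist_nonneg) auto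
    finally show ?thesis by simp
  qed
  have "(\<lambda>n. (1 / 2) ^ N * (1 / 2 :: real) ^ Suc n) sums ((1 / 2) ^ N * 1)"
    by (rule sums_mult[OF half])
  then have tail_sums: "(\<lambda>n. (1 / 2 :: real) ^ Suc (n + N)) sums ((1 / 2) ^ N)"
    by (simp add: power_add algebra_simps)
  have "(\<Sum>n. rho_term (Suc (n + N)) g h) \<le> (\<Sum>n. (1 / 2) ^ Suc (n + N))"
    by (intro suminf_le rho_term_le sums_summable[OF tail_sums])
      (use summable_iff_shift[of "\<lambda>n. rho_term (Suc n) g h" N] summable_rho_term[of g h] in simp)
  then have tail: "(\<Sum>n. rho_term (Suc (n + N)) g h) \<le> (1 / 2) ^ N"
    using sums_unique[OF tail_sums] by simp
  show ?thesis
    using head tail suminf_split_initial_segment[OF summable_rho_term[of g h], of N]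
    by (simp add: dist_curve_def)
qed

lemma rho_term_le_dist: "rho_term (Suc n) g h \<le> dist g h"
  using sum_le_suminf[OF summable_rho_term[of g h], of "{n}"]
  by (simp add: dist_curve_def rho_term_nonneg)

text \<open>A single term of the series is bounded by the whole, and c / (1 + c) is increasing in c.
  The threshold is the value of \<open>rho_term (Suc n)\<close> at distance \<open>e\<close>.
  Passing to the window \<open>Suc n\<close> also covers \<open>n = 0\<close>, which has no term in
  the series.\<close>

lemma maxdist_less_if_dist_less:
  assumes "e > 0"
  shows "\<exists>d>0. \<forall>g h. dist g h < d \<longrightarrow> maxdist n g h < e"
proof (intro exI[of _ "1 / 2 ^ Suc n * (e / (1 + e))"] conjI allI impI)
  show "1 / 2 ^ Suc n * (e / (1 + e)) > 0" using assms by simp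
  fix g h :: "'a curve"
  assume "dist g h < 1 / 2 ^ Suc n * (e / (1 + e))"
  then have "rho_term (Suc n) g h < 1 / 2 ^ Suc n * (e / (1 + e))"
    using rho_term_le_dist[of n g h] by linarith
  then have "maxdist (Suc n) g h / (1 + maxdist (Suc n) g h) < e / (1 + e)"
    unfolding rho_term_def by (subst (asm) mult_less_cancel_left_pos) auto
  then have "maxdist (Suc n) g h < e"
    using assms maxdist_nonneg[of "Suc n" g h] by (simp add: field_simps)
  then show "maxdist n g h < e"
    using maxdist_mono[of n "Suc n" g h] by simp
qed

text \<open>The metric induces the compact-open topology: convergence means uniform convergence on
  every window [-n, n]. The two preceding estimates between \<open>dist\<close> and
  \<open>maxdist\<close> give the two directions.\<close>

lemma tendsto_curve_iff:
  "(f \<longlongrightarrow> g) F \<longleftrightarrow> (\<forall>n. ((\<lambda>x. maxdist n (f x) g) \<longlongrightarrow> 0) F)"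
proof
  assume f: "(f \<longlongrightarrow> g) F"
  show "\<forall>n. ((\<lambda>x. maxdist n (f x) g) \<longlongrightarrow> 0) F"
  proof (intro allI tendstoI)
    fix n and e :: real assume "e > 0"
    then obtain d where d: "d > 0" "\<And>g h :: 'b curve. dist g h < d \<Longrightarrow> maxdist n g h < e"
      using maxdist_less_if_dist_less by blast
    show "\<forall>\<^sub>F x in F. dist (maxdist n (f x) g) 0 < e"
      using tendstoD[OF f d(1)] by eventually_elim (simp add: d(2) maxdist_nonneg)
  qed
next
  assume f: "\<forall>n. ((\<lambda>x. maxdist n (f x) g) \<longlongrightarrow> 0) F"
  show "(f \<longlongrightarrow> g) F"
  proof (rule tendstoI)
    fix e :: real assume "e > 0"
    then obtain N where N: "(1 / 2) ^ N < e / 2"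
      using real_arch_pow_inv[of "e / 2" "1 / 2"] by auto
    have "\<forall>\<^sub>F x in F. dist (maxdist N (f x) g) 0 < e / 2"
      using f \<open>e > 0\<close> by (intro tendstoD) auto
    then show "\<forall>\<^sub>F x in F. dist (f x) g < e"
    proof eventually_elim
      case (elim x)
      then show ?case
        using dist_curve_le[of "f x" g N] N maxdist_nonneg[of N "f x" g] by simp
    qed
  qed
qed

lemma tendsto_curve_apply:
  assumes "(f \<longlongrightarrow> g) F"
  shows "((\<lambda>x. curve_apply (f x) t) \<longlongrightarrow> curve_apply g t) F"
proof -
  obtain n where n: "\<bar>t\<bar> \<le> real n" using real_arch_simple by blast
  have "((\<lambda>x. maxdist n (f x) g) \<longlongrightarrow> 0) F"
    using assms by (simp only: tendsto_curve_iff)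
  then have "((\<lambda>x. dist (curve_apply (f x) t) (curve_apply g t)) \<longlongrightarrow> 0) F"
    by (rule Lim_null_comparison[rotated]) (simp add: dist_le_maxdist[OF n])
  then show ?thesis by (rule iffD2[OF tendsto_dist_iff])
qed

lemma continuous_on_curve_apply: "continuous_on S (\<lambda>g. curve_apply g t)"
  by (auto simp: continuous_on_def intro!: tendsto_curve_apply)

lemma continuous_on_shift: "continuous_on S (shift \<tau>)"
  unfolding continuous_on_def
proof
  fix g assume "g \<in> S"
  show "(shift \<tau> \<longlongrightarrow> shift \<tau> g) (at g within S)"
    unfolding tendsto_curve_iff
  proof
    fix n
    \<comment> \<open>The window [-n, n] translated by \<open>\<tau>\<close> stays inside
      [-m, m].\<close>
    define m where "m = n + nat \<lceil>\<bar>\<tau>\<bar>\<rceil>"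
    have le: "maxdist n (shift \<tau> h) (shift \<tau> g) \<le> maxdist m h g" for h
      unfolding maxdist_le_iff[of n] shift.rep_eq
    proof
      fix t assume "t \<in> {- real n..real n}"
      then have "\<bar>t + \<tau>\<bar> \<le> real m"
        unfolding m_def by (auto simp: abs_le_iff) linarith+
      then show "dist (curve_apply h (t + \<tau>)) (curve_apply g (t + \<tau>)) \<le> maxdist m h g"
        by (rule dist_le_maxdist)
    qed
    have "((\<lambda>h. h) \<longlongrightarrow> g) (at g within S)" by (rule tendsto_ident_at)
    then have "((\<lambda>h. maxdist m h g) \<longlongrightarrow> 0) (at g within S)"
      by (simp only: tendsto_curve_iff)
    then show "((\<lambda>h. maxdist n (shift \<tau> h) (shift \<tau> g)) \<longlongrightarrow> 0) (at g within S)"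
      by (rule Lim_null_comparison[rotated]) (simp add: le maxdist_nonneg)
  qed
qed

lemma shift_shift: "shift a (shift b g) = shift (a + b) g"
  by (simp add: curve_apply_inject[symmetric] fun_eq_iff shift.rep_eq add.assoc)

lemma shift_0 [simp]: "shift 0 g = g"
  by (simp add: curve_apply_inject[symmetric] fun_eq_iff shift.rep_eq)

section \<open>Minimal sets and recurrence\<close>

text \<open>Compactness keeps the intersection of a chain of nonempty closed invariant subsets
  nonempty, as Zorn's lemma requires. Invariance is an inclusion here; for the shifts, which are
  invertible, it amounts to equality.\<close>

lemma ex_minimal_invariant_subset:
  fixes T :: "'i \<Rightarrow> 'b::t2_space \<Rightarrow> 'b"
  assumes "compact K" "K \<noteq> {}" "\<And>i. T i ` K \<subseteq> K"
  obtains M where "M \<subseteq> K" "compact M" "M \<noteq> {}" "\<And>i. T i ` M \<subseteq> M"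
    "\<And>L. L \<subseteq> M \<Longrightarrow> closed L \<Longrightarrow> L \<noteq> {} \<Longrightarrow> (\<And>i. T i ` L \<subseteq> L) \<Longrightarrow> L = M"
proof -
  \<comment> \<open>Zorn's lemma is applied to the complements, for which it gives a maximal element.\<close>
  define \<U> where "\<U> = {U. open U \<and> - K \<subseteq> U \<and> \<not> K \<subseteq> U \<and> (\<forall>i. T i ` (- U) \<subseteq> - U)}"
  have "- K \<in> \<U>"
    using assms compact_imp_closed[OF assms(1)] by (auto simp: \<U>_def)
  have "\<exists>U\<in>\<U>. \<forall>X\<in>\<U>. U \<subseteq> X \<longrightarrow> X = U"
  proof (rule subset_Zorn_nonempty)
    show "\<U> \<noteq> {}" using \<open>- K \<in> \<U>\<close> by blast
    fix \<C> assume \<C>: "\<C> \<noteq> {}" "subset.chain \<U> \<C>"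
    then have sub: "\<C> \<subseteq> \<U>" by (simp add: subset.chain_def)
    \<comment> \<open>A finite subcover taken from a chain contains its own union, so a single
      member of \<open>\<U>\<close> would cover \<open>K\<close>.\<close>
    have "\<not> K \<subseteq> \<Union>\<C>"
    proof
      assume "K \<subseteq> \<Union>\<C>"
      then obtain \<D> where \<D>: "\<D> \<subseteq> \<C>" "finite \<D>" "K \<subseteq> \<Union>\<D>"
        using compactE[OF \<open>compact K\<close>, of \<C>] sub by (auto simp: \<U>_def)
      then have "\<D> \<noteq> {}" using \<open>K \<noteq> {}\<close> by auto
      moreover have "subset.chain \<U> \<D>"
        using \<C>(2) \<D>(1) unfolding subset.chain_def by blast
      ultimately have "\<Union>\<D> \<in> \<D>" using \<D>(2) by (intro Union_in_chain)
      then show False using \<D>(1,3) sub by (auto simp: \<U>_def)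
    qed
    moreover have "open (\<Union>\<C>)" "- K \<subseteq> \<Union>\<C>"
      using sub \<C>(1) unfolding \<U>_def by (blast intro: open_Union)+
    moreover have "T i ` (- \<Union>\<C>) \<subseteq> - \<Union>\<C>" for i
    proof -
      have "T i ` (- U) \<subseteq> - U" if "U \<in> \<C>" for U
        using sub that by (auto simp: \<U>_def)
      then show ?thesis by blast
    qed
    ultimately show "\<Union>\<C> \<in> \<U>" by (simp add: \<U>_def)
  qed
  then obtain U where U: "U \<in> \<U>" "\<And>X. X \<in> \<U> \<Longrightarrow> U \<subseteq> X \<Longrightarrow> X = U" by blast
  show thesis
  proof
    show "- U \<subseteq> K" "- U \<noteq> {}" "\<And>i. T i ` (- U) \<subseteq> - U"
      using U(1) by (auto simp: \<U>_def)
    have "- U = K \<inter> - U" using U(1) by (auto simp: \<U>_def)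
    moreover have "compact (K \<inter> - U)"
      using U(1) assms(1) by (intro compact_Int_closed) (auto simp: \<U>_def)
    ultimately show "compact (- U)" by metis
    fix L assume L: "L \<subseteq> - U" "closed L" "L \<noteq> {}" "\<And>i. T i ` L \<subseteq> L"
    have "- L \<in> \<U>" using L U(1) by (auto simp: \<U>_def open_closed)
    then have "- L = U" using U(2)[of "- L"] L(1) by blast
    then show "L = - U" by blast
  qed
qed

text \<open>
  Birkhoff's theorem. By minimality every orbit in \<open>M\<close> meets the ball around \<open>g\<close>, and compactness
  makes the entrance times uniformly bounded.
\<close>

lemma recurrent_if_minimal:
  assumes M: "compact M" "\<And>t. shift t ` M \<subseteq> M"
    and min: "\<And>L. L \<subseteq> M \<Longrightarrow> closed L \<Longrightarrow> L \<noteq> {} \<Longrightarrow> (\<And>t. shift t ` L \<subseteq> L) \<Longrightarrow> L = M"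
    and "g \<in> M"
  shows "recurrent g"
  unfolding recurrent_def
proof
  have orbit_sub: "range (\<lambda>t. shift t h) \<subseteq> M" if "h \<in> M" for h
    using M(2) that by blast
  have hull_sub: "hull_of h \<subseteq> M" if "h \<in> M" for h
    unfolding hull_of_def
    by (rule closure_minimal[OF orbit_sub[OF that] compact_imp_closed[OF M(1)]])
  \<comment> \<open>The hull is a nonempty closed shift-invariant subset of \<open>M\<close>, so
    minimality applies. Thus every orbit in \<open>M\<close> is dense in \<open>M\<close>.\<close>
  have hull: "hull_of h = M" if "h \<in> M" for h
  proof (rule min[OF hull_sub[OF that]])
    show "closed (hull_of h)" "hull_of h \<noteq> {}" by (auto simp: hull_of_def)
    have "shift t ` range (\<lambda>t. shift t h) \<subseteq> closure (range (\<lambda>t. shift t h))" for t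
      by (auto simp: shift_shift intro!: closure_subset[THEN subsetD])
    then show "shift t ` hull_of h \<subseteq> hull_of h" for t
      unfolding hull_of_def
      by (intro image_closure_subset continuous_on_shift) auto
  qed
  show "compact (hull_of g)" using hull[OF \<open>g \<in> M\<close>] M(1) by simp
  show "\<forall>\<epsilon>>0. \<exists>l>0. \<forall>a. infdist g ((\<lambda>t. shift t g) ` {a..a + l}) < \<epsilon>"
  proof (intro allI impI)
    fix \<epsilon> :: real assume "\<epsilon> > 0"
    have "open (shift t -` ball g \<epsilon>)" for t
      by (intro open_vimage continuous_on_shift) auto
    moreover have "M \<subseteq> (\<Union>t. shift t -` ball g \<epsilon>)"
    proof
      fix h assume "h \<in> M"
      then have "g \<in> closure (range (\<lambda>t. shift t h))"
        using hull \<open>g \<in> M\<close> unfolding hull_of_def by blast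
      then obtain t where "dist (shift t h) g < \<epsilon>"
        using \<open>\<epsilon> > 0\<close> unfolding closure_approachable by auto
      then show "h \<in> (\<Union>t. shift t -` ball g \<epsilon>)" by (auto simp: dist_commute)
    qed
    ultimately obtain C where C: "finite C" "M \<subseteq> (\<Union>t\<in>C. shift t -` ball g \<epsilon>)"
      using compactE_image[OF M(1), of UNIV "\<lambda>t. shift t -` ball g \<epsilon>"] by auto
    obtain B where B: "\<And>t. t \<in> C \<Longrightarrow> \<bar>t\<bar> \<le> B"
      using finite_imp_bounded[OF C(1)] by (auto simp: bounded_iff)
    \<comment> \<open>All entrance times lie in [-T, T]. Counted from the midpoint
      \<open>a + T\<close>, they fall into the window \<open>{a..a + 2 * T}\<close>. The maximum
      with 1 makes the window length positive.\<close>
    define T where "T = max B 1"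
    show "\<exists>l>0. \<forall>a. infdist g ((\<lambda>t. shift t g) ` {a..a + l}) < \<epsilon>"
    proof (intro exI[of _ "2 * T"] conjI allI)
      show "0 < 2 * T" by (simp add: T_def)
      fix a
      have "shift (a + T) g \<in> M" using orbit_sub \<open>g \<in> M\<close> by blast
      then obtain t where t: "t \<in> C" "dist g (shift (t + (a + T)) g) < \<epsilon>"
        using C(2) by (auto simp: shift_shift)
      have "\<bar>t\<bar> \<le> T" using B[OF t(1)] by (simp add: T_def)
      then have "t + (a + T) \<in> {a..a + 2 * T}" by auto
      then have "infdist g ((\<lambda>t. shift t g) ` {a..a + 2 * T}) \<le> dist g (shift (t + (a + T)) g)"
        by (intro infdist_le) blast
      then show "infdist g ((\<lambda>t. shift t g) ` {a..a + 2 * T}) < \<epsilon>"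
        using t(2) by linarith
    qed
  qed
qed

text \<open>Recurrence in the curve metric yields recurrence of single values: closeness of
  \<open>g\<close> and \<open>shift t g\<close> on a window containing \<open>s\<close> compares
  \<open>g\<close> at times \<open>s\<close> and \<open>s + t\<close>. The bound \<open>l\<close>
  depends on \<open>s\<close> and \<open>e\<close> but is uniform in \<open>a\<close>.\<close>

lemma recurrent_returns:
  assumes "recurrent g" "e > 0"
  obtains l where "\<And>a. \<exists>t\<in>{a..a + l}. dist (curve_apply g s) (curve_apply g t) < e"
proof -
  obtain n where n: "\<bar>s\<bar> \<le> real n" using real_arch_simple by blast
  obtain d where d: "d > 0" "\<And>g h :: 'a curve. dist g h < d \<Longrightarrow> maxdist n g h < e"
    using maxdist_less_if_dist_less[OF assms(2)] by blast
  obtain l where l: "l > 0" "\<And>a. infdist g ((\<lambda>t. shift t g) ` {a..a + l}) < d"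
    using assms(1) d(1) unfolding recurrent_def by blast
  show thesis
  proof
    fix a
    \<comment> \<open>Starting the window at \<open>a - s\<close> places the return time
      \<open>s + t\<close> in \<open>{a..a + l}\<close>.\<close>
    have "infdist g ((\<lambda>t. shift t g) ` {a - s..a - s + l}) < d" by (rule l)
    then obtain t where t: "t \<in> {a - s..a - s + l}" "dist g (shift t g) < d"
      using cINF_greatest[of "(\<lambda>t. shift t g) ` {a - s..a - s + l}" d "dist g"] l(1)
      by (fastforce simp: infdist_def not_less)
    have "dist (curve_apply g s) (curve_apply g (s + t)) < e"
      using d(2)[OF t(2)] dist_le_maxdist[OF n, of g "shift t g"] by (simp add: shift.rep_eq)
    then show "\<exists>t\<in>{a..a + l}. dist (curve_apply g s) (curve_apply g t) < e"
      using t(1) by (intro bexI[of _ "s + t"]) auto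
  qed
qed

section \<open>Full solutions of a semiflow\<close>

lemma semiflow_add: "semiflow \<Phi> \<Longrightarrow> 0 \<le> s \<Longrightarrow> 0 \<le> t \<Longrightarrow> \<Phi> t (\<Phi> s x) = \<Phi> (t + s) x"
  by (simp add: semiflow_def)

lemma continuous_on_semiflow:
  assumes "semiflow \<Phi>" "continuous_on S f" "continuous_on S g" "\<And>s. s \<in> S \<Longrightarrow> f s \<ge> 0"
  shows "continuous_on S (\<lambda>s. \<Phi> (f s) (g s))"
  using continuous_on_compose2[of "{0..} \<times> UNIV" "\<lambda>(t, x). \<Phi> t x" S "\<lambda>s. (f s, g s)"] assms
  by (auto simp: semiflow_def intro!: continuous_on_Pair)

lemma full_solutionD:
  assumes "full_solution \<Phi> \<gamma>" "0 \<le> t"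
  shows "\<Phi> t (\<gamma> s) = \<gamma> (s + t)"
proof -
  have "s \<le> s + t" using assms(2) by simp
  then have "\<gamma> (s + t) = \<Phi> (s + t - s) (\<gamma> s)"
    using assms(1) unfolding solution_on_def by blast
  then show ?thesis by simp
qed

text \<open>Read \<open>z n\<close> as the state at time -n. Running the semiflow from there gives a
  solution on [-n, \<infinity>), and the condition on \<open>z\<close> makes these solutions agree
  on overlaps, so they paste together.\<close>

lemma full_solution_from_history:
  assumes sf: "semiflow \<Phi>" and z: "\<And>n. \<Phi> 1 (z (Suc n)) = z n"
  obtains g where "full_solution \<Phi> (curve_apply g)"
    "\<And>n t. - real n \<le> t \<Longrightarrow> curve_apply g t = \<Phi> (t + real n) (z n)"
proof -
  have ext: "\<Phi> (t + real (n + k)) (z (n + k)) = \<Phi> (t + real n) (z n)" if "- real n \<le> t" for t n k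
  proof (induction k)
    case (Suc k)
    have "\<Phi> (t + real (n + Suc k)) (z (n + Suc k)) = \<Phi> (t + real (n + k)) (\<Phi> 1 (z (Suc (n + k))))"
      using that semiflow_add[OF sf, of 1 "t + real (n + k)"] by (simp add: algebra_simps)
    then show ?case using Suc z by simp
  qed simp
  \<comment> \<open>The least admissible starting index for \<open>t\<close> is used; by
    \<open>ext\<close>, any larger one gives the same value.\<close>
  define \<gamma> where "\<gamma> t = \<Phi> (t + real (nat \<lceil>- t\<rceil>)) (z (nat \<lceil>- t\<rceil>))" for t
  have \<gamma>: "\<gamma> t = \<Phi> (t + real n) (z n)" if "- real n \<le> t" for t n
  proof -
    have "nat \<lceil>- t\<rceil> \<le> n" using that by (simp add: nat_le_iff ceiling_le_iff)
    then obtain k where "n = nat \<lceil>- t\<rceil> + k" using le_Suc_ex by blast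
    moreover have "- real (nat \<lceil>- t\<rceil>) \<le> t" by linarith
    ultimately show ?thesis using ext by (simp add: \<gamma>_def)
  qed
  have "continuous_on UNIV \<gamma>"
  proof (intro continuous_at_imp_continuous_on ballI)
    fix t
    \<comment> \<open>The strict inequality puts \<open>t\<close> into an open half-line on which a
      single formula describes \<open>\<gamma>\<close>.\<close>
    obtain n where "- t < real n" using reals_Archimedean2 by blast
    then have t: "t \<in> {- real n<..}" by auto
    have "continuous_on {- real n<..} (\<lambda>t. \<Phi> (t + real n) (z n))"
      by (rule continuous_on_semiflow[OF sf]) (auto intro!: continuous_intros)
    then have "continuous_on {- real n<..} \<gamma>"
      by (rule continuous_on_eq) (auto simp: \<gamma>[of n])
    then show "isCont \<gamma> t"
      using t continuous_on_eq_continuous_at[of "{- real n<..}"] by auto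
  qed
  then have app: "curve_apply (Curve \<gamma>) = \<gamma>" by (simp add: Curve_inverse)
  have "\<gamma> t = \<Phi> (t - s) (\<gamma> s)" if "s \<le> t" for s t
  proof -
    obtain n where n: "- s \<le> real n" using real_arch_simple by blast
    show ?thesis
      using \<gamma>[of n s] \<gamma>[of n t] n that semiflow_add[OF sf, of "s + real n" "t - s" "z n"] by simp
  qed
  then show thesis
    using that[of "Curve \<gamma>"] \<gamma> by (auto simp: app solution_on_def)
qed

section \<open>Compactness of the set of full solutions inside an invariant set\<close>

definition solution_curves :: "(real \<Rightarrow> 'a::metric_space \<Rightarrow> 'a) \<Rightarrow> 'a set \<Rightarrow> 'a curve set" where
  "solution_curves \<Phi> A = {g. full_solution \<Phi> (curve_apply g) \<and> range (curve_apply g) \<subseteq> A}"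

lemma solution_curves_forward:
  assumes "g \<in> solution_curves \<Phi> A" "0 \<le> t"
  shows "\<Phi> t (curve_apply g s) = curve_apply g (s + t)"
  using assms full_solutionD unfolding solution_curves_def by blast

lemma shift_solution_curves: "shift t ` solution_curves \<Phi> A \<subseteq> solution_curves \<Phi> A"
proof
  fix h assume "h \<in> shift t ` solution_curves \<Phi> A"
  then obtain g where h: "h = shift t g" and g: "g \<in> solution_curves \<Phi> A" by blast
  have "curve_apply g (r + t) = \<Phi> (r - s) (curve_apply g (s + t))" if "s \<le> r" for r s
    using solution_curves_forward[OF g, of "r - s" "s + t"] that by (simp add: algebra_simps)
  then show "h \<in> solution_curves \<Phi> A"
    using g unfolding solution_curves_def solution_on_def h by (auto simp: shift.rep_eq)
qed

lemma solution_curve_from_history: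
  assumes "semiflow \<Phi>" "invariant \<Phi> A" "\<And>n. \<Phi> 1 (z (Suc n)) = z n" "\<And>n. z n \<in> A"
  obtains g where "g \<in> solution_curves \<Phi> A"
    "\<And>n t. - real n \<le> t \<Longrightarrow> curve_apply g t = \<Phi> (t + real n) (z n)"
proof -
  obtain g where g: "full_solution \<Phi> (curve_apply g)"
    "\<And>n t. - real n \<le> t \<Longrightarrow> curve_apply g t = \<Phi> (t + real n) (z n)"
    using full_solution_from_history[OF assms(1), of z, OF assms(3)] by metis
  have "curve_apply g t \<in> A" for t
  proof -
    obtain n where n: "- t \<le> real n" using real_arch_simple by blast
    then have "\<Phi> (t + real n) ` A = A" using assms(2) by (simp add: invariant_def)
    then show ?thesis using g(2)[of n t] n assms(4)[of n] by auto
  qed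
  with g show thesis by (intro that[of g]) (auto simp: solution_curves_def)
qed

text \<open>Since \<open>\<Phi> 1\<close> maps \<open>A\<close> onto \<open>A\<close>, dependent
  choice selects successive preimages within \<open>A\<close>, which form a history.\<close>

lemma solution_curves_nonempty:
  assumes "semiflow \<Phi>" "invariant \<Phi> A" "A \<noteq> {}"
  shows "solution_curves \<Phi> A \<noteq> {}"
proof -
  have "\<exists>y. y \<in> A \<and> \<Phi> 1 y = x" if "x \<in> A" for x
  proof -
    have "\<Phi> 1 ` A = A" using assms(2) by (simp add: invariant_def)
    then show ?thesis using that by (metis imageE)
  qed
  moreover obtain x where "x \<in> A" using assms(3) by blast
  ultimately obtain z where "\<And>n :: nat. z n \<in> A" "\<And>n. \<Phi> 1 (z (Suc n)) = z n"
    using dependent_nat_choice[of "\<lambda>_ x. x \<in> A" "\<lambda>_ x y. \<Phi> 1 y = x"] by metis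
  then show ?thesis using solution_curve_from_history[OF assms(1,2), of z] by blast
qed

lemma compact_solution_curves:
  assumes sf: "semiflow \<Phi>" and inv: "invariant \<Phi> A" and "compact A"
  shows "compact (solution_curves \<Phi> A)"
  unfolding compact_eq_seq_compact_metric
proof (rule seq_compactI)
  fix g :: "nat \<Rightarrow> 'a curve" assume g: "\<forall>k. g k \<in> solution_curves \<Phi> A"
  define z where "z k n = curve_apply (g k) (- real n)" for k n
  have "compactin (product_topology (\<lambda>_ :: nat. euclidean :: 'a topology) UNIV) (PiE UNIV (\<lambda>_. A))"
    using \<open>compact A\<close> by (simp add: compactin_PiE)
  then have "compact (PiE UNIV (\<lambda>_ :: nat. A))"
    by (simp add: euclidean_product_topology)
  \<comment> \<open>The product has countably many factors, hence is first countable, so compactness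
    yields convergent subsequences.\<close>
  then have seq: "seq_compact (PiE UNIV (\<lambda>_ :: nat. A))"
    by (rule compact_imp_seq_compact)
  have zA: "z k n \<in> A" for k n
    using g unfolding z_def solution_curves_def by blast
  then have "\<forall>k. z k \<in> PiE UNIV (\<lambda>_. A)" by auto
  then obtain w r where w: "w \<in> PiE UNIV (\<lambda>_. A)" and r: "strict_mono r"
    and lim: "(z \<circ> r) \<longlonglongrightarrow> w"
    using seq by (metis seq_compactE)
  have lim_n: "(\<lambda>k. z (r k) n) \<longlonglongrightarrow> w n" for n
    using continuous_on_tendsto_compose[OF continuous_on_product_coordinates[where i = n] lim]
    by (simp add: o_def)
  have wA: "w n \<in> A" for n using w by auto
  \<comment> \<open>By continuity of \<open>\<Phi> 1\<close>, the coordinatewise limit of histories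
    is again a history.\<close>
  have step: "\<Phi> 1 (w (Suc n)) = w n" for n
  proof (rule LIMSEQ_unique)
    have "continuous_on UNIV (\<Phi> 1)"
      using continuous_on_semiflow[OF sf, of UNIV "\<lambda>_. 1" "\<lambda>x. x"] by simp
    then show "(\<lambda>k. \<Phi> 1 (z (r k) (Suc n))) \<longlonglongrightarrow> \<Phi> 1 (w (Suc n))"
      by (rule continuous_on_tendsto_compose[OF _ lim_n]) auto
    have "\<Phi> 1 (z (r k) (Suc n)) = z (r k) n" for k
      using solution_curves_forward[of "g (r k)" \<Phi> A 1] g by (simp add: z_def)
    then show "(\<lambda>k. \<Phi> 1 (z (r k) (Suc n))) \<longlonglongrightarrow> w n" using lim_n by simp
  qed
  obtain h where h: "h \<in> solution_curves \<Phi> A"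
    "\<And>n t. - real n \<le> t \<Longrightarrow> curve_apply h t = \<Phi> (t + real n) (w n)"
    using solution_curve_from_history[OF sf inv, of w, OF step wA] by blast
  have "(g \<circ> r) \<longlonglongrightarrow> h"
    unfolding tendsto_curve_iff
  proof (intro allI tendstoI)
    fix n and e :: real assume "e > 0"
    \<comment> \<open>On [-n, n] a solution is the semiflow run for a time in [0, 2n] from its state
      at time -n. Uniform continuity on this compact set turns convergence of those states into
      uniform convergence of the curves.\<close>
    have "continuous_on ({0..2 * real n} \<times> A) (\<lambda>p. \<Phi> (fst p) (snd p))"
      by (rule continuous_on_semiflow[OF sf]) (auto intro!: continuous_intros)
    then have "uniformly_continuous_on ({0..2 * real n} \<times> A) (\<lambda>p. \<Phi> (fst p) (snd p))"
      using \<open>compact A\<close> by (intro compact_uniformly_continuous compact_Times) auto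
    then obtain d where d: "d > 0" "\<And>p q. p \<in> {0..2 * real n} \<times> A \<Longrightarrow> q \<in> {0..2 * real n} \<times> A \<Longrightarrow>
        dist p q < d \<Longrightarrow> dist (\<Phi> (fst p) (snd p)) (\<Phi> (fst q) (snd q)) < e"
      using \<open>e > 0\<close> unfolding uniformly_continuous_on_def by metis
    have "\<forall>\<^sub>F k in sequentially. dist (z (r k) n) (w n) < d"
      by (rule tendstoD[OF lim_n d(1)])
    then show "\<forall>\<^sub>F k in sequentially. dist (maxdist n ((g \<circ> r) k) h) 0 < e"
    proof eventually_elim
      case (elim k)
      obtain t where t: "t \<in> {- real n..real n}"
        "maxdist n (g (r k)) h = dist (curve_apply (g (r k)) t) (curve_apply h t)"
        using maxdist_attained by blast
      have "curve_apply (g (r k)) t = \<Phi> (t + real n) (z (r k) n)"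
        using solution_curves_forward[of "g (r k)" \<Phi> A "t + real n" "- real n"] g t(1)
        by (simp add: z_def)
      then have "dist (curve_apply (g (r k)) t) (curve_apply h t) < e"
        using d(2)[of "(t + real n, z (r k) n)" "(t + real n, w n)"] elim t(1) wA zA h(2)[of n t]
        by (simp add: dist_Pair_Pair)
      then show ?case using t(2) maxdist_nonneg[of n "g (r k)" h] by simp
    qed
  qed
  with h(1) r show "\<exists>h\<in>solution_curves \<Phi> A. \<exists>r. strict_mono r \<and> (g \<circ> r) \<longlonglongrightarrow> h" by blast
qed

text \<open>The image under \<open>\<Phi> t\<close> contains the range, because every
  \<open>\<gamma> s\<close> comes from \<open>\<gamma> (s - t)\<close>. Compactness makes this image
  closed, so it contains the closure as well.\<close>

lemma invariant_closure_range:
  assumes sf: "semiflow \<Phi>" and sol: "full_solution \<Phi> \<gamma>" and "compact (closure (range \<gamma>))"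
  shows "invariant \<Phi> (closure (range \<gamma>))"
  unfolding invariant_def
proof (intro allI impI)
  fix t :: real assume t: "0 \<le> t"
  have cont: "continuous_on S (\<Phi> t)" for S
    using continuous_on_semiflow[OF sf, of S "\<lambda>_. t" "\<lambda>x. x"] t by simp
  note fwd = full_solutionD[OF sol t]
  show "\<Phi> t ` closure (range \<gamma>) = closure (range \<gamma>)"
  proof
    show "\<Phi> t ` closure (range \<gamma>) \<subseteq> closure (range \<gamma>)"
      by (rule image_closure_subset[OF cont])
        (auto simp: fwd intro!: closure_subset[THEN subsetD])
    have "\<gamma> s \<in> \<Phi> t ` closure (range \<gamma>)" for s
      using fwd[of "s - t"] closure_subset[of "range \<gamma>"] by (auto intro!: image_eqI[of _ _ "\<gamma> (s - t)"])
    moreover have "closed (\<Phi> t ` closure (range \<gamma>))"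
      by (intro compact_imp_closed compact_continuous_image cont assms)
    ultimately show "closure (range \<gamma>) \<subseteq> \<Phi> t ` closure (range \<gamma>)"
      by (intro closure_minimal) auto
  qed
qed

section \<open>Compact minimal sets and recurrent solutions\<close>

lemma recurrent_solution_through:
  assumes sf: "semiflow \<Phi>" and A: "compact A" "minimal_set \<Phi> A" and "x \<in> A"
  obtains g where "full_solution \<Phi> (curve_apply g)" "recurrent g" "curve_apply g 0 = x"
    "A = closure (range (curve_apply g))"
proof -
  have inv: "invariant \<Phi> A" and min: "\<And>L. L \<subseteq> A \<Longrightarrow> L \<noteq> {} \<Longrightarrow> closed L \<Longrightarrow> invariant \<Phi> L \<Longrightarrow> L = A"
    using A(2) unfolding minimal_set_def by blast+
  have "solution_curves \<Phi> A \<noteq> {}"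
    using solution_curves_nonempty[OF sf inv] \<open>x \<in> A\<close> by blast
  then obtain M where M: "M \<subseteq> solution_curves \<Phi> A" "compact M" "M \<noteq> {}" "\<And>t. shift t ` M \<subseteq> M"
    and M_min: "\<And>L. L \<subseteq> M \<Longrightarrow> closed L \<Longrightarrow> L \<noteq> {} \<Longrightarrow> (\<And>t. shift t ` L \<subseteq> L) \<Longrightarrow> L = M"
    using ex_minimal_invariant_subset[OF compact_solution_curves[OF sf inv A(1)], of shift]
      shift_solution_curves by metis
  have "(\<lambda>g. curve_apply g 0) ` M = A"
  proof (rule min)
    show "(\<lambda>g. curve_apply g 0) ` M \<subseteq> A" using M(1) by (auto simp: solution_curves_def)
    show "(\<lambda>g. curve_apply g 0) ` M \<noteq> {}" using M(3) by simp
    show "closed ((\<lambda>g. curve_apply g 0) ` M)"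
      by (intro compact_imp_closed compact_continuous_image continuous_on_curve_apply M(2))
    show "invariant \<Phi> ((\<lambda>g. curve_apply g 0) ` M)"
      unfolding invariant_def
    proof (intro allI impI)
      fix t :: real assume "0 \<le> t"
      then have "\<Phi> t (curve_apply g 0) = curve_apply (shift t g) 0" if "g \<in> M" for g
        using solution_curves_forward[of g \<Phi> A t 0] that M(1) by (auto simp: shift.rep_eq)
      then have "\<Phi> t ` (\<lambda>g. curve_apply g 0) ` M = (\<lambda>g. curve_apply g 0) ` shift t ` M"
        by (simp add: image_image)
      \<comment> \<open>The inclusion for \<open>- t\<close> supplies preimages under
        \<open>shift t\<close>, which upgrades the inclusion to equality.\<close>
      moreover have "shift t ` M = M"
      proof
        have "h \<in> shift t ` M" if "h \<in> M" for h
          using M(4)[of "- t"] that by (intro image_eqI[of _ _ "shift (- t) h"]) (auto simp: shift_shift)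
        then show "M \<subseteq> shift t ` M" by blast
      qed (rule M(4))
      ultimately show "\<Phi> t ` (\<lambda>g. curve_apply g 0) ` M = (\<lambda>g. curve_apply g 0) ` M" by simp
    qed
  qed
  then obtain g where g: "g \<in> M" "curve_apply g 0 = x" using \<open>x \<in> A\<close> by blast
  have sol: "full_solution \<Phi> (curve_apply g)" and "range (curve_apply g) \<subseteq> A"
    using g(1) M(1) by (auto simp: solution_curves_def)
  then have sub: "closure (range (curve_apply g)) \<subseteq> A"
    using compact_imp_closed[OF A(1)] by (intro closure_minimal)
  then have "compact (closure (range (curve_apply g)))"
    using compact_Int_closed[OF A(1), of "closure (range (curve_apply g))"] by (simp add: Int_absorb1)
  \<comment> \<open>Minimality of \<open>A\<close> is used a second time, now for the orbit closure
    of the chosen solution.\<close>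
  then have "closure (range (curve_apply g)) = A"
    using sub by (intro min invariant_closure_range[OF sf sol]) auto
  then show thesis
    using that[of g] sol recurrent_if_minimal[OF M(2,4) M_min g(1)] g(2) by blast
qed

section \<open>Closures of recurrent solutions are compact and minimal\<close>

lemma compact_closure_range_if_recurrent:
  assumes "recurrent g"
  shows "compact (closure (range (curve_apply g)))"
proof -
  \<comment> \<open>Evaluation at 0 sends \<open>shift t g\<close> to the value of \<open>g\<close>
    at \<open>t\<close>, so the compact image of the hull contains the range of
    \<open>g\<close>.\<close>
  have "compact ((\<lambda>h. curve_apply h 0) ` hull_of g)" (is "compact ?K")
    using assms by (intro compact_continuous_image continuous_on_curve_apply) (simp add: recurrent_def)
  moreover have "range (curve_apply g) \<subseteq> ?K"
  proof
    fix y assume "y \<in> range (curve_apply g)"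
    then obtain t where "y = curve_apply (shift t g) 0" by (auto simp: shift.rep_eq)
    then show "y \<in> ?K"
      using closure_subset[of "range (\<lambda>t. shift t g)"] unfolding hull_of_def by blast
  qed
  ultimately have "?K \<inter> closure (range (curve_apply g)) = closure (range (curve_apply g))"
    by (intro Int_absorb1 closure_minimal compact_imp_closed)
  then show ?thesis
    using compact_Int_closed[OF \<open>compact ?K\<close> closed_closure, of "range (curve_apply g)"] by simp
qed

lemma minimal_set_closure_range:
  assumes sf: "semiflow \<Phi>" and sol: "full_solution \<Phi> (curve_apply g)" and rec: "recurrent g"
  shows "minimal_set \<Phi> (closure (range (curve_apply g)))" (is "minimal_set \<Phi> ?A")
proof -
  have cpt: "compact ?A" by (rule compact_closure_range_if_recurrent[OF rec])
  have "L = ?A" if L: "L \<subseteq> ?A" "L \<noteq> {}" "closed L" "invariant \<Phi> L" for L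
  proof -
    obtain y where y: "y \<in> L" using L(2) by blast
    then obtain u where u: "\<And>n. u n \<in> range (curve_apply g)" "u \<longlonglongrightarrow> y"
      using L(1) closure_sequential[of y "range (curve_apply g)"] by auto
    have "\<exists>t. u n = curve_apply g t" for n using u(1)[of n] by blast
    then obtain T where T: "\<And>n. u n = curve_apply g (T n)" by metis
    have "curve_apply g s \<in> L" for s
    proof -
      have "\<exists>v\<in>L. dist v (curve_apply g s) < e" if "e > 0" for e
      proof -
        \<comment> \<open>The bound \<open>l\<close> is fixed before \<open>n\<close>, so the delays
          \<open>r n\<close> below stay in one compact interval. The radius \<open>e / 2\<close>
          leaves room for the strict inequality to weaken in the limit.\<close>
        obtain l where l: "\<And>a. \<exists>t\<in>{a..a + l}. dist (curve_apply g s) (curve_apply g t) < e / 2"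
          using recurrent_returns[OF rec, of "e / 2" s] \<open>e > 0\<close> by auto
        have "\<exists>r\<in>{0..l}. dist (curve_apply g s) (\<Phi> r (u n)) < e / 2" for n
        proof -
          obtain t where t: "t \<in> {T n..T n + l}" "dist (curve_apply g s) (curve_apply g t) < e / 2"
            using l by blast
          have "curve_apply g t = \<Phi> (t - T n) (u n)"
            using sol t(1) unfolding solution_on_def T by simp
          then show ?thesis using t by (intro bexI[of _ "t - T n"]) auto
        qed
        then obtain r where r: "\<And>n. r n \<in> {0..l}"
          "\<And>n. dist (curve_apply g s) (\<Phi> (r n) (u n)) < e / 2"
          by metis
        obtain q \<sigma> where q: "q \<in> {0..l}" "strict_mono \<sigma>" "(r \<circ> \<sigma>) \<longlonglongrightarrow> q"
          using compact_Icc[of 0 l] r(1) unfolding compact_eq_seq_compact_metric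
          by (metis seq_compactE)
        \<comment> \<open>Delays and starting points converge together, so joint continuity of the
          semiflow identifies the limit as \<open>\<Phi> q y\<close>, a point on the forward orbit
          of \<open>y\<close>.\<close>
        have "(\<lambda>n. ((r \<circ> \<sigma>) n, (u \<circ> \<sigma>) n)) \<longlonglongrightarrow> (q, y)"
          by (intro tendsto_Pair q(3) LIMSEQ_subseq_LIMSEQ[OF u(2) q(2)])
        moreover have "continuous_on ({0..} \<times> UNIV) (\<lambda>(t, x). \<Phi> t x)"
          using sf by (simp add: semiflow_def)
        ultimately have "(\<lambda>n. \<Phi> (r (\<sigma> n)) (u (\<sigma> n))) \<longlonglongrightarrow> \<Phi> q y"
          using continuous_on_tendsto_compose[of "{0..} \<times> UNIV" "\<lambda>(t, x). \<Phi> t x"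
              "\<lambda>n. ((r \<circ> \<sigma>) n, (u \<circ> \<sigma>) n)" "(q, y)" sequentially] q(1) r(1)
          by auto
        then have "(\<lambda>n. dist (curve_apply g s) (\<Phi> (r (\<sigma> n)) (u (\<sigma> n))))
            \<longlonglongrightarrow> dist (curve_apply g s) (\<Phi> q y)"
          by (intro tendsto_intros)
        then have "dist (curve_apply g s) (\<Phi> q y) \<le> e / 2"
          by (rule LIMSEQ_le_const2) (use r(2) in \<open>auto intro!: exI[of _ 0] less_imp_le\<close>)
        moreover have "\<Phi> q y \<in> L"
        proof -
          have "\<Phi> q ` L = L" using L(4) q(1) by (auto simp: invariant_def)
          then show ?thesis using y by blast
        qed
        ultimately show ?thesis using \<open>e > 0\<close> by (intro bexI[of _ "\<Phi> q y"]) (auto simp: dist_commute)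
      qed
      then have "curve_apply g s \<in> closure L" by (simp add: closure_approachable)
      then show ?thesis using L(3) by simp
    qed
    then have "?A \<subseteq> L" using L(3) by (intro closure_minimal) auto
    then show ?thesis using L(1) by blast
  qed
  then show ?thesis
    using invariant_closure_range[OF sf sol cpt] unfolding minimal_set_def by auto
qed

theorem theorem3p1:
  fixes \<Phi> :: "real \<Rightarrow> 'a::complete_space \<Rightarrow> 'a" and A :: "'a set"
  assumes "semiflow \<Phi>" and "A \<noteq> {}"
  shows "compact A \<and> minimal_set \<Phi> A \<longleftrightarrow>
    (\<forall>x\<in>A. \<exists>\<gamma>. recurrent_solution \<Phi> \<gamma> \<and> through_on UNIV \<gamma> x \<and> A = closure (range \<gamma>))"
proof
  assume A: "compact A \<and> minimal_set \<Phi> A"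
  show "\<forall>x\<in>A. \<exists>\<gamma>. recurrent_solution \<Phi> \<gamma> \<and> through_on UNIV \<gamma> x \<and> A = closure (range \<gamma>)"
  proof
    fix x assume "x \<in> A"
    then obtain g where "full_solution \<Phi> (curve_apply g)" "recurrent g" "curve_apply g 0 = x"
      "A = closure (range (curve_apply g))"
      using recurrent_solution_through[OF assms(1)] A by metis
    then show "\<exists>\<gamma>. recurrent_solution \<Phi> \<gamma> \<and> through_on UNIV \<gamma> x \<and> A = closure (range \<gamma>)"
      by (intro exI[of _ "curve_apply g"]) (auto simp: recurrent_solution_def through_on_def)
  qed
next
  assume "\<forall>x\<in>A. \<exists>\<gamma>. recurrent_solution \<Phi> \<gamma> \<and> through_on UNIV \<gamma> x \<and> A = closure (range \<gamma>)"
  \<comment> \<open>Nonemptiness of \<open>A\<close> provides a point at which to apply the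
    hypothesis, which would otherwise be vacuous.\<close>
  then obtain g where "full_solution \<Phi> (curve_apply g)" "recurrent g"
    "A = closure (range (curve_apply g))"
    using assms(2) unfolding recurrent_solution_def by blast
  then show "compact A \<and> minimal_set \<Phi> A"
    using compact_closure_range_if_recurrent minimal_set_closure_range[OF assms(1)] by blast
qed

end
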